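(* Let $(X,d)$ be a nonempty metric space and let $F: X \to BN(X)$ be a multi-valued map. Suppose that $X$ is $F$-orbitally complete and that $F$ is a generalized quasi-contraction with constant $q\in[0,1)$, i.e. for all $x,y\in X$, $$\rho(Fx,Fy) \le q \max\big\{d(x,y),\, \rho(x,Fx),\, \rho(y,Fy),\, D(x,Fy),\, D(y,Fx),\, D(F^2x,x),\, D(F^2x,Fx),\, D(F^2x,y),\, D(F^2x,Fy)\big\}.$$ Let $a$ be any fixed real number with $0<a<1$. Then: (1) $F$ has a unique fixed point $x^*$ in $X$, and $Fx^*=\{x^*\}$. (2) For each $x_0 \in X$ there exists an orbit $\{x_n\}_n$ of $F$ at $x_0$ such that $\lim_{n\to\infty} x_n = x^*$, and (3) this orbit satisfies $d(x_n,x^* ) \le \dfrac{(q^{1-a})^n}{1-q^{1-a}}\, d(x_0,x_1)$ for all $n\in\mathbb{N}$.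
   Context: For nonempty subsets $A,B$ of a metric space $(X,d)$: $D(A,B)=\inf\{d(a,b): a\in A, b\in B\}$ and $\rho(A,B)=\sup\{d(a,b): a\in A, b\in B\}$; when one of the sets is a singleton $\{x\}$ one writes $x$ in place of $\{x\}$, so $D(x,B)=D(\{x\},B)$, $D(A,x)=D(A,\{x\})$, $\rho(x,B)=\rho(\{x\},B)$. $BN(X)$ is the family of nonempty bounded subsets of $X$, i.e. nonempty $A\subset X$ with $\delta(A):=\sup\{d(a,b):a,b\in A\}<+\infty$. For $F:X\to BN(X)$ and $x\in X$, $F^2x=\bigcup_{z\in Fx}Fz$. A fixed point of $F$ is a point $x\in X$ with $x\in Fx$. For $x_0\in X$, an orbit of $F$ at $x_0$ is a sequence $\{x_n\}_n$ starting at $x_0$ with $x_n\in Fx_{n-1}$ for all $n \ge 1$. The space $X$ is called $F$-orbitally complete if every Cauchy sequence which is a subsequence of an orbit of $F$ at $x$, for some $x\in X$, converges in $X$. A multi-valued map $F: X\to BN(X)$ is called a generalized quasi-contraction if there exists $q\in[0,1)$ such that the inequality displayed in the claim holds for all $x,y\in X$. $\mathbb{N}$ denotes the positive integers. *)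

theory Defs
  imports "HOL-Analysis.Analysis"
begin

text \<open>
  The metric space \<open>X\<close> is a type of class \<^class>\<open>metric_space\<close> (hence nonempty), and a
  multi-valued map is a function \<open>F :: 'a \<Rightarrow> 'a set\<close>. The gap \<open>D(A,B)\<close> is \<^const>\<open>setdist\<close>,
  which is the infimum of the distances whenever both sets are nonempty.
\<close>

text \<open>
  Finiteness of \<open>\<delta>(A)\<close> is \<^const>\<open>bounded\<close>; the real-valued \<^const>\<open>diameter\<close>
  cannot express it.
\<close>

definition BN :: "'a::metric_space set set" where
  "BN = {A. A \<noteq> {} \<and> bounded A}"

text \<open>
  A real supremum, meaningful for nonempty bounded arguments; \<open>rho\<close> is only applied to
  singletons and to values of maps into \<^const>\<open>BN\<close>.
\<close>

definition rho :: "'a::metric_space set \<Rightarrow> 'a set \<Rightarrow> real" where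
  "rho A B = Sup {dist a b | a b. a \<in> A \<and> b \<in> B}"

definition F_sq :: "('a \<Rightarrow> 'a set) \<Rightarrow> 'a \<Rightarrow> 'a set" where
  "F_sq F x = (\<Union>z\<in>F x. F z)"

definition fixed_point :: "('a \<Rightarrow> 'a set) \<Rightarrow> 'a \<Rightarrow> bool" where
  "fixed_point F x \<longleftrightarrow> x \<in> F x"

definition orbit_at :: "('a \<Rightarrow> 'a set) \<Rightarrow> 'a \<Rightarrow> (nat \<Rightarrow> 'a) \<Rightarrow> bool" where
  "orbit_at F x0 x \<longleftrightarrow> x 0 = x0 \<and> (\<forall>n\<ge>1. x n \<in> F (x (n - 1)))"

definition orbitally_complete :: "('a::metric_space \<Rightarrow> 'a set) \<Rightarrow> bool" where
  "orbitally_complete F \<longleftrightarrow>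
     (\<forall>x0 x r. orbit_at F x0 x \<and> strict_mono (r :: nat \<Rightarrow> nat) \<and> Cauchy (x \<circ> r)
        \<longrightarrow> convergent (x \<circ> r))"

definition generalized_quasi_contraction ::
    "real \<Rightarrow> ('a::metric_space \<Rightarrow> 'a set) \<Rightarrow> bool" where
  "generalized_quasi_contraction q F \<longleftrightarrow>
     (\<forall>x. F x \<in> BN) \<and> 0 \<le> q \<and> q < 1 \<and>
     (\<forall>x y. rho (F x) (F y) \<le> q * Max {
        dist x y,
        rho {x} (F x),
        rho {y} (F y),
        setdist {x} (F y),
        setdist {y} (F x),
        setdist (F_sq F x) {x},
        setdist (F_sq F x) (F x),
        setdist (F_sq F x) {y},
        setdist (F_sq F x) (F y)})"

end

theory Submission
  imports Defs
begin

text \<open>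
  Choose a selection \<open>T\<close> of \<open>F\<close> that moves every point almost as far as possible,
  \<open>q\<^sup>a \<rho>(x, Fx) \<le> d(x, Tx)\<close>. As \<open>q = q\<^sup>1\<^sup>-\<^sup>a q\<^sup>a\<close>, the map \<open>T\<close> satisfies the single-valued form of
  the contractive condition with constant \<open>k = q\<^sup>1\<^sup>-\<^sup>a\<close>. Ciric's argument for quasi-contractions then
  applies to \<open>T\<close>: the diameter of the orbit of \<open>x\<close> is at most \<open>d(x, Tx) / (1 - k)\<close>, and each step along
  the orbit shrinks the diameter of the tail by the factor \<open>k\<close>. Hence orbits of \<open>T\<close>, which are
  orbits of \<open>F\<close>, converge geometrically, and their limits are fixed by \<open>T\<close>. Finally, \<open>T\<close> fixes
  \<open>x\<close> exactly when \<open>Fx = {x}\<close>, and every fixed point of \<open>F\<close> is of this kind.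
\<close>

section \<open>Single-valued generalized quasi-contractions and their orbit diameters\<close>

definition generalized_quasi_contraction_single ::
    "real \<Rightarrow> ('a::metric_space \<Rightarrow> 'a) \<Rightarrow> bool" where
  "generalized_quasi_contraction_single k T \<longleftrightarrow> 0 \<le> k \<and> k < 1 \<and>
     (\<forall>x y. dist (T x) (T y) \<le> k * Max {
        dist x y, dist x (T x), dist y (T y), dist x (T y), dist y (T x),
        dist (T (T x)) x, dist (T (T x)) (T x), dist (T (T x)) y, dist (T (T x)) (T y)})"

lemma generalized_quasi_contraction_single_constant:
  assumes "generalized_quasi_contraction_single k T"
  shows "0 \<le> k" "k < 1"
  using assms unfolding generalized_quasi_contraction_single_def by blast+

lemma generalized_quasi_contraction_singleD:
  assumes "generalized_quasi_contraction_single k T"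
    and "dist x y \<le> M" "dist x (T x) \<le> M" "dist y (T y) \<le> M" "dist x (T y) \<le> M"
      "dist y (T x) \<le> M" "dist (T (T x)) x \<le> M" "dist (T (T x)) (T x) \<le> M"
      "dist (T (T x)) y \<le> M" "dist (T (T x)) (T y) \<le> M"
  shows "dist (T x) (T y) \<le> k * M"
proof -
  have "Max {dist x y, dist x (T x), dist y (T y), dist x (T y), dist y (T x),
      dist (T (T x)) x, dist (T (T x)) (T x), dist (T (T x)) y, dist (T (T x)) (T y)} \<le> M"
    by (rule Max.boundedI) (use assms(2-) in blast)+
  then show ?thesis
    using assms(1) unfolding generalized_quasi_contraction_single_def
    by (meson mult_left_mono order_trans)
qed

text \<open>For the points \<open>(T ^^ i) x\<close> and \<open>(T ^^ j) x\<close> the condition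
  involves only the iterates of index \<open>i\<close>, \<open>i + 1\<close>, \<open>i + 2\<close>,
  \<open>j\<close>, \<open>j + 1\<close>. Since \<open>i < j\<close> gives
  \<open>i + 2 \<le> j + 1\<close>, all of these lie in \<open>{i..Suc j}\<close>.\<close>

lemma dist_iterates_Suc_le:
  assumes T: "generalized_quasi_contraction_single k T"
    and "i < j"
    and M: "\<And>p r. p \<in> {i..Suc j} \<Longrightarrow> r \<in> {i..Suc j} \<Longrightarrow> dist ((T ^^ p) x) ((T ^^ r) x) \<le> M"
  shows "dist ((T ^^ Suc i) x) ((T ^^ Suc j) x) \<le> k * M"
proof -
  have M': "dist ((T ^^ p) x) ((T ^^ r) x) \<le> M" if "p \<in> {i, Suc i, Suc (Suc i), j, Suc j}"
    "r \<in> {i, Suc i, Suc (Suc i), j, Suc j}" for p r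
    using M[of p r] that \<open>i < j\<close> by auto
  have "dist (T ((T ^^ i) x)) (T ((T ^^ j) x)) \<le> k * M"
    by (rule generalized_quasi_contraction_singleD[OF T])
      (use M'[of i j] M'[of i "Suc i"] M'[of j "Suc j"] M'[of i "Suc j"] M'[of j "Suc i"]
        M'[of "Suc (Suc i)" i] M'[of "Suc (Suc i)" "Suc i"] M'[of "Suc (Suc i)" j]
        M'[of "Suc (Suc i)" "Suc j"] in auto)
  then show ?thesis by simp
qed

text \<open>Let \<open>Max S\<close> be the diameter of the segment up to index \<open>N\<close>.
  Iterates of positive index are at most \<open>k * Max S\<close> apart, and a detour through
  \<open>T x\<close> handles index 0. So \<open>Max S \<le> dist x (T x) + k * Max S\<close>, and
  solving for \<open>Max S\<close> gives a bound free of \<open>N\<close>.\<close>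

lemma dist_iterates_le:
  assumes T: "generalized_quasi_contraction_single k T"
  shows "dist ((T ^^ i) x) ((T ^^ j) x) \<le> dist x (T x) / (1 - k)"
proof -
  have k: "0 \<le> k" "k < 1" using generalized_quasi_contraction_single_constant[OF T] by auto
  define N where "N = max i j"
  define S where "S = (\<lambda>(i, j). dist ((T ^^ i) x) ((T ^^ j) x)) ` ({..N} \<times> {..N})"
  have S: "finite S" "S \<noteq> {}" by (auto simp: S_def)
  have le: "dist ((T ^^ p) x) ((T ^^ r) x) \<le> Max S" if "p \<le> N" "r \<le> N" for p r
    by (rule Max_ge[OF S(1)]) (use that in \<open>auto simp: S_def\<close>)
  have "0 \<le> Max S" using le[of 0 0] by simp
  have lt: "dist ((T ^^ p) x) ((T ^^ r) x) \<le> k * Max S" if "1 \<le> p" "p < r" "r \<le> N" for p r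
  proof -
    \<comment> \<open>The indices \<open>p - 1\<close> to \<open>r\<close> that enter here do not
      exceed \<open>N\<close>, so \<open>Max S\<close> bounds all the distances used.\<close>
    have "dist ((T ^^ Suc (p - 1)) x) ((T ^^ Suc (r - 1)) x) \<le> k * Max S"
      by (rule dist_iterates_Suc_le[OF T]) (use that in \<open>auto intro!: le\<close>)
    then show ?thesis using that by (simp del: funpow.simps)
  qed
  have tail: "dist ((T ^^ p) x) ((T ^^ r) x) \<le> k * Max S"
    if "1 \<le> p" "1 \<le> r" "p \<le> N" "r \<le> N" for p r
    using lt[of p r] lt[of r p] that k \<open>0 \<le> Max S\<close>
    by (cases p r rule: linorder_cases) (auto simp: dist_commute)
  have head: "dist x ((T ^^ r) x) \<le> dist x (T x) + k * Max S" if "r \<le> N" for r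
  proof (cases "r = 0")
    case True
    then show ?thesis using k \<open>0 \<le> Max S\<close> by simp
  next
    case False
    then show ?thesis
      using tail[of 1 r] that dist_triangle[of x "(T ^^ r) x" "T x"] by auto
  qed
  have "dist ((T ^^ p) x) ((T ^^ r) x) \<le> dist x (T x) + k * Max S" if "p \<le> N" "r \<le> N" for p r
  proof (cases "p = 0 \<or> r = 0")
    case True
    then show ?thesis using head[of r] head[of p] that by (auto simp: dist_commute)
  next
    case False
    then show ?thesis using tail[of p r] that by (smt (verit) zero_le_dist less_one not_le)
  qed
  then have "Max S \<le> dist x (T x) + k * Max S"
    using S by (subst Max_le_iff) (auto simp: S_def)
  then have "Max S \<le> dist x (T x) / (1 - k)"
    using k by (simp add: pos_le_divide_eq algebra_simps)
  then show ?thesis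
    using le[of i j] by (simp add: N_def)
qed

text \<open>Induction on \<open>n\<close>: if both indices are at least \<open>Suc n\<close>, their
  predecessors are at least \<open>n\<close>, so the induction hypothesis bounds every distance in
  the contractive condition, which adds one factor \<open>k\<close>.\<close>

lemma dist_iterates_tail_le:
  assumes T: "generalized_quasi_contraction_single k T"
    and "n \<le> i" "n \<le> j"
  shows "dist ((T ^^ i) x) ((T ^^ j) x) \<le> k ^ n * (dist x (T x) / (1 - k))"
  using assms(2,3)
proof (induction n arbitrary: i j)
  case 0
  then show ?case using dist_iterates_le[OF T] by simp
next
  case (Suc n)
  have k: "0 \<le> k" "k < 1" using generalized_quasi_contraction_single_constant[OF T] by auto
  have *: "dist ((T ^^ p) x) ((T ^^ r) x) \<le> k ^ Suc n * (dist x (T x) / (1 - k))"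
    if "Suc n \<le> p" "p < r" for p r
  proof -
    have "dist ((T ^^ Suc (p - 1)) x) ((T ^^ Suc (r - 1)) x)
        \<le> k * (k ^ n * (dist x (T x) / (1 - k)))"
      by (rule dist_iterates_Suc_le[OF T]) (use that Suc.IH in auto)
    then show ?thesis using that by (simp del: funpow.simps add: mult.assoc)
  qed
  show ?case
    using *[of i j] *[of j i] Suc.prems k
    by (cases i j rule: linorder_cases) (auto simp: dist_commute)
qed

section \<open>Limits of iterates and fixed points of \<open>T\<close>\<close>

lemma Cauchy_iterates:
  assumes T: "generalized_quasi_contraction_single k T"
  shows "Cauchy (\<lambda>n. (T ^^ n) x)"
proof (rule metric_CauchyI)
  fix e :: real assume "0 < e"
  have k: "0 \<le> k" "k < 1" using generalized_quasi_contraction_single_constant[OF T] by auto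
  have "(\<lambda>n. k ^ n * (dist x (T x) / (1 - k))) \<longlonglongrightarrow> 0"
    using k by (intro tendsto_mult_left_zero LIMSEQ_realpow_zero)
  then obtain n where "k ^ n * (dist x (T x) / (1 - k)) < e"
    using \<open>0 < e\<close> by (metis (no_types, lifting) eventually_sequentially order_refl order_tendstoD(2))
  then show "\<exists>M. \<forall>m\<ge>M. \<forall>n\<ge>M. dist ((T ^^ m) x) ((T ^^ n) x) < e"
    using dist_iterates_tail_le[OF T] by (meson le_less_trans)
qed

text \<open>The second index in the tail estimate is sent to infinity.\<close>

lemma dist_iterates_limit_le:
  assumes T: "generalized_quasi_contraction_single k T"
    and u: "(\<lambda>n. (T ^^ n) x) \<longlonglongrightarrow> u"
  shows "dist ((T ^^ n) x) u \<le> k ^ n / (1 - k) * dist x (T x)"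
proof -
  have "(\<lambda>m. dist ((T ^^ n) x) ((T ^^ m) x)) \<longlonglongrightarrow> dist ((T ^^ n) x) u"
    using u by (intro tendsto_dist tendsto_const)
  then have "dist ((T ^^ n) x) u \<le> k ^ n * (dist x (T x) / (1 - k))"
    by (rule LIMSEQ_le_const2) (use dist_iterates_tail_le[OF T] in blast)
  then show ?thesis by simp
qed

text \<open>\<open>T\<close> may be discontinuous, so the contractive condition is applied to
  \<open>(T ^^ n) x\<close> and \<open>u\<close> instead. As \<open>n\<close> grows, all nine
  distances are bounded by \<open>dist u (T u)\<close> up to a null sequence, whence
  \<open>dist u (T u) \<le> k * dist u (T u)\<close>.\<close>

lemma limit_of_iterates_fixed:
  assumes T: "generalized_quasi_contraction_single k T"
    and u: "(\<lambda>n. (T ^^ n) x) \<longlonglongrightarrow> u"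
  shows "T u = u"
proof -
  define e where "e n = dist ((T ^^ n) x) u" for n
  have e: "e \<longlonglongrightarrow> 0" unfolding e_def using tendsto_dist[OF u tendsto_const[of u]] by simp
  have e0: "0 \<le> e n" for n by (simp add: e_def)
  \<comment> \<open>This null sequence dominates the sum of any two of the three distances to
    \<open>u\<close>, hence by the triangle inequality the mutual distances of the three
    iterates.\<close>
  define E where "E n = e n + e (Suc n) + e (Suc (Suc n))" for n
  have "E \<longlonglongrightarrow> 0 + 0 + 0"
    unfolding E_def using e LIMSEQ_Suc[OF e] LIMSEQ_Suc[OF LIMSEQ_Suc[OF e]]
    by (intro tendsto_add)
  then have "(\<lambda>n. e (Suc n) + k * (dist u (T u) + E n)) \<longlonglongrightarrow> 0 + k * (dist u (T u) + 0)"
    using LIMSEQ_Suc[OF e] by (intro tendsto_intros) auto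
  moreover have "dist u (T u) \<le> e (Suc n) + k * (dist u (T u) + E n)" for n
  proof -
    define y where "y = (T ^^ n) x"
    have e': "e n = dist y u" "e (Suc n) = dist (T y) u" "e (Suc (Suc n)) = dist (T (T y)) u"
      by (simp_all add: e_def y_def)
    have y: "0 \<le> E n" "dist y u \<le> E n" "dist (T y) u \<le> E n" "dist (T (T y)) u \<le> E n"
      "dist y u + dist (T y) u \<le> E n" "dist (T (T y)) u + dist y u \<le> E n"
      "dist (T (T y)) u + dist (T y) u \<le> E n"
      using e0[of n] e0[of "Suc n"] e0[of "Suc (Suc n)"] unfolding E_def e' by linarith+
    have near: "dist p r \<le> dist u (T u) + E n" if "dist p u + dist r u \<le> E n" for p r
      using that dist_triangle2[of p r u] zero_le_dist[of u "T u"] by linarith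
    have far: "dist p (T u) \<le> dist u (T u) + E n" if "dist p u \<le> E n" for p
      using that dist_triangle[of p "T u" u] by linarith
    \<comment> \<open>The condition is not symmetric: with the iterate \<open>y\<close> in the first
      place, \<open>T (T y)\<close> occurs but \<open>T (T u)\<close> does not. Distances to
      \<open>T u\<close> are covered by \<open>far\<close>, the others by
      \<open>near\<close>.\<close>
    have "dist (T y) (T u) \<le> k * (dist u (T u) + E n)"
      by (rule generalized_quasi_contraction_singleD[OF T]; (rule far | rule near))
        (simp_all only: y dist_self add_0 add_0_right)
    then show ?thesis
      using dist_triangle[of u "T u" "T y"] by (simp add: e' dist_commute)
  qed
  ultimately have "dist u (T u) \<le> k * dist u (T u)"
    using LIMSEQ_le_const by fastforce
  moreover have "k < 1" using generalized_quasi_contraction_single_constant[OF T] by simp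
  ultimately show ?thesis
    by (smt (verit) mult_le_cancel_right1 zero_less_dist_iff)
qed

lemma fixed_point_single_unique:
  assumes T: "generalized_quasi_contraction_single k T"
    and "T u = u" "T v = v"
  shows "u = v"
proof -
  have "dist (T u) (T v) \<le> k * dist u v"
    by (rule generalized_quasi_contraction_singleD[OF T]) (simp_all add: assms(2,3) dist_commute)
  moreover have "k < 1" using generalized_quasi_contraction_single_constant[OF T] by simp
  ultimately show ?thesis
    using assms(2,3) by (smt (verit) mult_le_cancel_right1 zero_less_dist_iff)
qed

section \<open>Estimates for \<open>rho\<close> and the choice of a selection\<close>

lemma dist_le_rho:
  assumes "bounded A" "bounded B" "x \<in> A" "y \<in> B"
  shows "dist x y \<le> rho A B"
  unfolding rho_def
proof (rule cSup_upper)
  obtain c where c: "\<forall>z\<in>A \<union> B. dist x z \<le> c"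
    using assms(1,2) by (meson bounded_Un bounded_any_center)
  have "dist y z \<le> c + c" if "y \<in> A" "z \<in> B" for y z
    using c that dist_triangle3[of y z x] by (smt (verit) UnI1 UnI2)
  then show "bdd_above {dist y z |y z. y \<in> A \<and> z \<in> B}"
    by (intro bdd_aboveI[of _ "c + c"]) auto
qed (use assms in blast)

lemma rho_le:
  assumes "A \<noteq> {}" "B \<noteq> {}" "\<And>x y. x \<in> A \<Longrightarrow> y \<in> B \<Longrightarrow> dist x y \<le> c"
  shows "rho A B \<le> c"
  unfolding rho_def by (rule cSup_least) (use assms in auto)

text \<open>
  For \<open>c > 0\<close> the second conjunct follows from the first; it matters when \<open>q = 0\<close>, where
  \<open>0 powr a = 0\<close> makes the first one void.
\<close>

lemma exists_almost_farthest:
  assumes A: "A \<in> BN" and c: "0 \<le> c" "c < 1"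
  shows "\<exists>z\<in>A. c * rho {x} A \<le> dist x z \<and> (z = x \<longrightarrow> A = {x})"
proof (cases "A = {x}")
  case True
  then have "rho {x} A = 0" by (simp add: rho_def)
  then show ?thesis using True by auto
next
  case False
  have ne: "A \<noteq> {}" and bd: "bounded A" using A by (auto simp: BN_def)
  from False ne obtain w where "w \<in> A" "w \<noteq> x" by blast
  then have pos: "0 < rho {x} A"
    using dist_le_rho[of "{x}" A x w] bd by (smt (verit) bounded_insert bounded_empty insertI1 zero_less_dist_iff)
  \<comment> \<open>Otherwise \<open>c * rho {x} A\<close> bounds all distances from
    \<open>x\<close> to \<open>A\<close>, so the supremum is at most \<open>c\<close> times itself
    although it is positive.\<close>
  have "\<exists>z\<in>A. c * rho {x} A < dist x z"
  proof (rule ccontr)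
    assume "\<not> ?thesis"
    then have "rho {x} A \<le> c * rho {x} A"
      using ne by (intro rho_le) auto
    then show False using pos c by simp
  qed
  then obtain z where "z \<in> A" "c * rho {x} A < dist x z" by blast
  \<comment> \<open>Together with the strict inequality this yields
    \<open>z \<noteq> x\<close>.\<close>
  moreover have "0 \<le> c * rho {x} A" using c pos by simp
  ultimately show ?thesis by (intro bexI[of _ z]) auto
qed

text \<open>On the left, \<open>dist (T x) (T y) \<le> rho (F x) (F y)\<close>. On the right, a gap
  is at most the distance of selected points and \<open>q \<le> k\<close>, while for the
  \<open>rho\<close> terms the factor \<open>q powr a\<close> of \<open>q = k * q powr a\<close> is
  spent on \<open>far\<close>.\<close>

lemma selection_generalized_quasi_contraction:
  fixes F :: "'a::metric_space \<Rightarrow> 'a set"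
  assumes F: "generalized_quasi_contraction q F"
    and a: "0 \<le> a" "a < 1"
    and TF: "\<And>x. T x \<in> F x"
    and far: "\<And>x. q powr a * rho {x} (F x) \<le> dist x (T x)"
  shows "generalized_quasi_contraction_single (q powr (1 - a)) T"
proof -
  have BN: "F x \<in> BN" for x
    using F unfolding generalized_quasi_contraction_def by blast
  have q: "0 \<le> q" "q < 1"
    using F unfolding generalized_quasi_contraction_def by blast+
  define k where "k = q powr (1 - a)"
  have k: "0 \<le> k" "k < 1"
    using q a powr_less_mono2[of "1 - a" q 1] by (auto simp: k_def)
  \<comment> \<open>This also covers \<open>q = 0\<close>, where both sides vanish.\<close>
  have qk: "q = k * q powr a"
    using q unfolding k_def powr_add[symmetric] by simp
  have "q \<le> k"
    using mult_left_mono[OF powr_le1[of a q] k(1)] a q qk by simp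
  have "dist (T x) (T y) \<le> k * M"
    if M: "M = Max {dist x y, dist x (T x), dist y (T y), dist x (T y), dist y (T x),
        dist (T (T x)) x, dist (T (T x)) (T x), dist (T (T x)) y, dist (T (T x)) (T y)}" for x y M
  proof -
    have le: "dist x y \<le> M" "dist x (T x) \<le> M" "dist y (T y) \<le> M" "dist x (T y) \<le> M"
      "dist y (T x) \<le> M" "dist (T (T x)) x \<le> M" "dist (T (T x)) (T x) \<le> M"
      "dist (T (T x)) y \<le> M" "dist (T (T x)) (T y) \<le> M"
      unfolding M by (rule Max_ge; simp)+
    have T2: "T (T x) \<in> F_sq F x" using TF by (auto simp: F_sq_def)
    have scale: "q * d \<le> k * M" if "d \<le> M" for d
      using that \<open>q \<le> k\<close> q zero_le_dist[of x y] le(1) k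
      by (meson mult_mono mult_left_mono mult_right_mono order_trans)
    have gap: "q * setdist A B \<le> k * M" if "u \<in> A" "v \<in> B" "dist u v \<le> M" for A B u v
      using that setdist_le_dist[of u A v B] by (intro scale) simp
    have reach: "q * rho {z} (F z) \<le> k * M" if "dist z (T z) \<le> M" for z
    proof -
      have "q * rho {z} (F z) = k * (q powr a * rho {z} (F z))"
        by (subst qk) simp
      also have "\<dots> \<le> k * M"
        using far[of z] that k by (intro mult_left_mono) auto
      finally show ?thesis .
    qed
    let ?S = "{dist x y, rho {x} (F x), rho {y} (F y), setdist {x} (F y), setdist {y} (F x),
      setdist (F_sq F x) {x}, setdist (F_sq F x) (F x), setdist (F_sq F x) {y},
      setdist (F_sq F x) (F y)}"
    \<comment> \<open>The factor \<open>q\<close> is kept because \<open>rho {x} (F x)\<close>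
      itself may exceed \<open>M\<close>. As the maximum is attained, bounding each
      \<open>q * s\<close> suffices.\<close>
    have "q * s \<le> k * M" if "s \<in> ?S" for s
      using that le scale[of "dist x y"] reach[of x] reach[of y]
        gap[of x "{x}" "T y" "F y"] gap[of y "{y}" "T x" "F x"]
        gap[OF T2, of x "{x}"] gap[OF T2, of "T x" "F x"]
        gap[OF T2, of y "{y}"] gap[OF T2, of "T y" "F y"] TF by auto
    moreover have "Max ?S \<in> ?S" by (rule Max_in) auto
    ultimately have "q * Max ?S \<le> k * M" by blast
    moreover have "rho (F x) (F y) \<le> q * Max ?S"
      using F by (simp only: generalized_quasi_contraction_def)
    moreover have "dist (T x) (T y) \<le> rho (F x) (F y)"
      using BN TF by (intro dist_le_rho) (auto simp: BN_def)
    ultimately show ?thesis by linarith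
  qed
  then show ?thesis
    using k by (simp only: generalized_quasi_contraction_single_def k_def[symmetric]) blast
qed

text \<open>Take both points equal to \<open>y\<close>. Since \<open>y\<close> lies in
  \<open>F y\<close> and in \<open>F_sq F y\<close>, every gap is zero, and
  \<open>rho {y} (F y)\<close> is at most the diameter \<open>R\<close> of \<open>F y\<close>. So
  \<open>R \<le> q * R\<close>, which forces \<open>R \<le> 0\<close>.\<close>

lemma fixed_point_value_singleton:
  assumes F: "generalized_quasi_contraction q F" and y: "y \<in> F y"
  shows "F y = {y}"
proof -
  have BN: "F x \<in> BN" for x
    using F unfolding generalized_quasi_contraction_def by blast
  have q: "0 \<le> q" "q < 1"
    using F unfolding generalized_quasi_contraction_def by blast+
  have bd: "bounded (F y)" using BN by (auto simp: BN_def)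
  define R where "R = rho (F y) (F y)"
  have R0: "0 \<le> R" using dist_le_rho[OF bd bd y y] by (simp add: R_def)
  have y2: "y \<in> F_sq F y" using y by (auto simp: F_sq_def)
  have gap: "setdist A B \<le> R" if "y \<in> A" "y \<in> B" for A B
    using setdist_le_dist[OF that] R0 by simp
  have reach: "rho {y} (F y) \<le> R"
    unfolding R_def using y bd by (intro rho_le dist_le_rho) auto
  let ?S = "{dist y y, rho {y} (F y), rho {y} (F y), setdist {y} (F y), setdist {y} (F y),
    setdist (F_sq F y) {y}, setdist (F_sq F y) (F y), setdist (F_sq F y) {y},
    setdist (F_sq F y) (F y)}"
  have "R \<le> q * Max ?S"
    using F unfolding generalized_quasi_contraction_def R_def by blast
  also have "\<dots> \<le> q * R"
  proof (rule mult_left_mono)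
    show "Max ?S \<le> R"
      using gap y y2 reach R0 by (intro Max.boundedI) auto
  qed (use q in simp)
  finally have "R \<le> 0" using q by (smt (verit) mult_le_cancel_right1)
  then have "dist y z \<le> 0" if "z \<in> F y" for z
    using dist_le_rho[OF bd bd y that] unfolding R_def by linarith
  then show ?thesis using y by auto
qed

section \<open>Transfer from the selection \<open>T\<close> back to \<open>F\<close>\<close>

theorem theorem3p4:
  fixes F :: "'a::metric_space \<Rightarrow> 'a set" and q a :: real
  assumes "\<And>x. F x \<in> BN"
    and "orbitally_complete F"
    and "generalized_quasi_contraction q F"
    and "0 < a" and "a < 1"
  shows "\<exists>xs. fixed_point F xs \<and> (\<forall>y. fixed_point F y \<longrightarrow> y = xs) \<and> F xs = {xs} \<and>
    (\<forall>x0. \<exists>x. orbit_at F x0 x \<and> x \<longlonglongrightarrow> xs \<and>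
       (\<forall>n\<ge>1. dist (x n) xs \<le> (q powr (1 - a)) ^ n / (1 - q powr (1 - a)) * dist (x 0) (x 1)))"
proof -
  define k where "k = q powr (1 - a)"
  have q: "0 \<le> q" "q < 1"
    using assms(3) unfolding generalized_quasi_contraction_def by blast+
  have "q powr a < 1"
    using powr_less_mono2[of a q 1] q \<open>0 < a\<close> by simp
  then have "\<exists>z\<in>F x. q powr a * rho {x} (F x) \<le> dist x z \<and> (z = x \<longrightarrow> F x = {x})" for x
    using assms(1) by (intro exists_almost_farthest) auto
  then obtain T where TF: "\<And>x. T x \<in> F x"
    and far: "\<And>x. q powr a * rho {x} (F x) \<le> dist x (T x)"
    and Tfix: "\<And>x. T x = x \<Longrightarrow> F x = {x}"
    by metis
  have T: "generalized_quasi_contraction_single k T"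
    unfolding k_def using assms(3) less_imp_le[OF assms(4)] assms(5) TF far by (rule selection_generalized_quasi_contraction)
  have orbit: "orbit_at F x0 (\<lambda>n. (T ^^ n) x0)" for x0
    unfolding orbit_at_def
  proof (intro conjI allI impI)
    fix n :: nat assume "1 \<le> n"
    then show "(T ^^ n) x0 \<in> F ((T ^^ (n - 1)) x0)"
      using TF by (cases n) auto
  qed simp
  \<comment> \<open>Orbital completeness is used with the whole orbit as its own subsequence,
    \<open>r = id\<close>.\<close>
  have conv: "\<exists>u. (\<lambda>n. (T ^^ n) x0) \<longlonglongrightarrow> u" for x0
    using assms(2) orbit[of x0] Cauchy_iterates[OF T, of x0] strict_mono_id
    unfolding orbitally_complete_def convergent_def by (metis comp_id)
  obtain u where "T u = u"
    using conv limit_of_iterates_fixed[OF T] by blast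
  \<comment> \<open>Each orbit of \<open>T\<close> converges to some fixed point of
    \<open>T\<close>; uniqueness makes \<open>u\<close> the limit for every starting point.\<close>
  have lim: "(\<lambda>n. (T ^^ n) x0) \<longlonglongrightarrow> u" for x0
    using conv[of x0] limit_of_iterates_fixed[OF T] fixed_point_single_unique[OF T \<open>T u = u\<close>]
    by metis
  have "F u = {u}" using Tfix \<open>T u = u\<close> .
  moreover have "y = u" if "fixed_point F y" for y
  proof -
    have "F y = {y}"
      using fixed_point_value_singleton[OF assms(3)] that by (simp add: fixed_point_def)
    \<comment> \<open>The only value available to the selection at \<open>y\<close> is
      \<open>y\<close>.\<close>
    then have "T y = y" using TF[of y] by simp
    then show ?thesis using fixed_point_single_unique[OF T _ \<open>T u = u\<close>] by blast
  qed
  moreover have "\<exists>x. orbit_at F x0 x \<and> x \<longlonglongrightarrow> u \<and>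
      (\<forall>n\<ge>1. dist (x n) u \<le> k ^ n / (1 - k) * dist (x 0) (x 1))" for x0
    using orbit[of x0] lim[of x0] dist_iterates_limit_le[OF T lim]
    by (intro exI[of _ "\<lambda>n. (T ^^ n) x0"]) auto
  ultimately show ?thesis
    unfolding k_def by (intro exI[of _ u]) (auto simp: fixed_point_def)
qed

end
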